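(* Let $\theta\neq0$. Let $X\sim\mathcal N(0,1)$ and let $S$ be a random variable independent of $X$ having a density $\rho$ on $[\sigma_0^2,\infty)$ with asymptotics $\rho(\sigma_0^2+s)\sim L(s)s^{\alpha}$ as $s\to0^+$, where $\alpha>-1$ and $L$ is slowly varying. Then, as $w\to\infty$, $$l^\theta(w\sqrt S X)-w^2\sigma_0^2-\frac{2}{\theta^2}\Big(2(1+\alpha)\ln w-\ln\big(\Gamma(1+\alpha)L(w^{-1})\big)+(1+\alpha)\ln(\theta^2/2)\Big)\longrightarrow0 .$$
   Context: $l^\theta(Z):=-\frac{2}{\theta^2}\ln\mathbb E[e^{i\theta Z}]$ for a random variable $Z$ with real positive characteristic function. $f\sim g$ means $f/g\to1$. $L$ is slowly varying (at $0$) if $L(cs)/L(s)\to1$ as $s\to0^+$ for every $c>0$. $\Gamma$ is the Gamma function.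
   Formalization: The term L(w^{-1}) is replaced by L(w^{-2}); with L(w^{-1}) the claim is false, e.g. for σ_0=0, α=0, θ=√2, ρ(s)=L(s)=-ln s on (0,1), where the difference tends to -ln 2. *)

theory Defs
  imports "HOL-Probability.Probability"
begin

definition real_positive_char :: "'a measure \<Rightarrow> ('a \<Rightarrow> real) \<Rightarrow> bool" where
  "real_positive_char M Z \<longleftrightarrow>
     (\<forall>t. \<exists>r::real. 0 < r \<and> char (distr M borel Z) t = complex_of_real r)"

(* Meaningful for real_positive_char M Z, where Re only changes the type of the
   (real) characteristic function. *)
definition l_theta :: "'a measure \<Rightarrow> real \<Rightarrow> ('a \<Rightarrow> real) \<Rightarrow> real" where
  "l_theta M \<theta> Z = - (2 / \<theta>\<^sup>2) * ln (Re (char (distr M borel Z) \<theta>))"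

definition slowly_varying_at_0 :: "(real \<Rightarrow> real) \<Rightarrow> bool" where
  "slowly_varying_at_0 L \<longleftrightarrow>
     (\<forall>c>0. ((\<lambda>s. L (c * s) / L s) \<longlongrightarrow> 1) (at_right 0))"

(* In the asymptotics of l_theta for w * sqrt S * X, L enters at the scale w^(-2), since the Laplace variable of S is
   w^2 * theta^2 / 2.  With L (1 / w) in its place the limit is false in general: for the
   density - ln s on (0, 1), with L s = - ln s, alpha = 0, sigma0 = 0 and theta = sqrt 2,
   the difference tends to - ln 2. *)

end

theory Submission
  imports Defs "HOL-Real_Asymp.Real_Asymp"
begin

text \<open>
  Conditioning on \<open>S\<close> turns the characteristic function of \<open>w \<surd>S X\<close> into the Laplace transform of the
  density of \<open>S\<close> at \<open>u = \<theta>\<^sup>2 w\<^sup>2 / 2\<close>, so the claim reduces to the Abelian statement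
  \<open>u \<phi>(u) / g(1/u) \<rightarrow> \<Gamma>(\<alpha> + 1)\<close> for the Laplace transform \<open>\<phi>\<close> of an integrable \<open>g \<ge> 0\<close> with
  \<open>g(c s) / g(s) \<rightarrow> c\<^sup>\<alpha>\<close>. Uniform convergence theorems and Potter bounds are avoided as follows. Integrating
  the ratio of \<open>g\<close> shows directly that \<open>\<phi>(u/c) / \<phi>(u) \<rightarrow> c\<close> to the power \<open>\<alpha> + 1\<close>. A Fatou argument
  bounds \<open>k(u) = g(1/u) / (u \<phi>(u))\<close> from above, and this bound provides the domination needed on compact
  subsets of \<open>(0, \<infinity>)\<close> for the reverse inequality; the mass of \<open>e\<^sup>-\<^sup>t g(t/u)\<close> near \<open>0\<close> and \<open>\<infinity>\<close> is
  controlled by \<open>\<phi>(u/a) / \<phi>(u)\<close> with \<open>a\<close> small and by \<open>\<phi>(u/2) / \<phi>(u)\<close>. The function \<open>L\<close> need not be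
  measurable, so it never appears under an integral.
\<close>

section \<open>Laplace transforms of integrable functions that vanish on the negative axis\<close>

definition laplace :: "(real \<Rightarrow> real) \<Rightarrow> real \<Rightarrow> real" where
  "laplace f u = (\<integral>t. exp (- (u * t)) * f t \<partial>lborel)"

lemma integrable_laplace:
  fixes f :: "real \<Rightarrow> real"
  assumes f: "integrable lborel f" and zero: "\<And>t. t < 0 \<Longrightarrow> f t = 0" and "u \<ge> 0"
  shows "integrable lborel (\<lambda>t. exp (- (u * t)) * f t)"
proof (rule Bochner_Integration.integrable_bound[OF f])
  have [measurable]: "f \<in> borel_measurable borel"
    using f by simp
  show "(\<lambda>t. exp (- (u * t)) * f t) \<in> borel_measurable lborel"
    by measurable
  show "AE t in lborel. norm (exp (- (u * t)) * f t) \<le> norm (f t)"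
  proof (rule AE_I2)
    fix t :: real
    \<comment> \<open>For \<open>t < 0\<close> the exponential may exceed 1, and the bound rests on
      the vanishing of \<open>f\<close> there.\<close>
    show "norm (exp (- (u * t)) * f t) \<le> norm (f t)"
      using zero[of t] \<open>u \<ge> 0\<close>
      by (cases "t < 0") (auto simp: abs_mult intro!: mult_left_le_one_le)
  qed
qed

lemma laplace_scale:
  assumes "c > 0"
  shows "laplace f (u / c) = c * laplace (\<lambda>t. f (c * t)) u"
  unfolding laplace_def
  using lborel_integral_real_affine[of c "\<lambda>t. exp (- (u / c * t)) * f t" 0] assms
  by simp

section \<open>Densities regularly varying at 0: positivity and bounds on the transform\<close>

locale regularly_varying_density =
  fixes g :: "real \<Rightarrow> real" and \<alpha> :: real
  assumes integrable: "integrable lborel g"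
    and nonneg: "\<And>t. g t \<ge> 0"
    and zero: "\<And>t. t < 0 \<Longrightarrow> g t = 0"
    and regular: "\<And>c. c > 0 \<Longrightarrow> ((\<lambda>s. g (c * s) / g s) \<longlongrightarrow> c powr \<alpha>) (at_right 0)"
    and alpha: "\<alpha> > -1"
begin

lemma measurable_g [measurable]: "g \<in> borel_measurable borel"
  using integrable by simp

lemma integrable_scaled: "c > 0 \<Longrightarrow> integrable lborel (\<lambda>t. g (c * t))"
  using lborel_integrable_real_affine[OF integrable, of c 0] by simp

text \<open>For \<open>c = 1\<close> the ratio in \<open>regular\<close> is
  \<open>g s / g s\<close>, which is 0 by convention wherever \<open>g s = 0\<close>. Its limit 1
  therefore rules out zeros near the origin.\<close>

lemma eventually_pos: "eventually (\<lambda>s. g s > 0) (at_right 0)"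
proof -
  have "eventually (\<lambda>s. g (1 * s) / g s > 0) (at_right 0)"
    using regular[of 1] by (intro order_tendstoD(1)) auto
  then show ?thesis
  proof eventually_elim
    case (elim s)
    then show ?case using nonneg[of s] by (cases "g s = 0") auto
  qed
qed

lemma integral_initial_pos:
  assumes "d > 0"
  shows "(\<integral>t. g t * indicator {0<..<d} t \<partial>lborel) > 0"
proof (rule ccontr)
  let ?h = "\<lambda>t. g t * indicator {0<..<d} t"
  have int: "integrable lborel ?h"
    using integrable by (intro integrable_real_mult_indicator) auto
  assume "\<not> ?thesis"
  moreover have "integral\<^sup>L lborel ?h \<ge> 0"
    by (intro integral_nonneg_AE) (auto simp: nonneg)
  ultimately have "integral\<^sup>L lborel ?h = 0"
    by simp
  then have ae: "AE t in lborel. ?h t = 0"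
    using integral_nonneg_eq_0_iff_AE[OF int] nonneg by simp
  obtain b where b: "b > 0" "\<And>s. 0 < s \<Longrightarrow> s < b \<Longrightarrow> g s > 0"
    using eventually_pos unfolding eventually_at_right_field by auto
  have "AE t in lborel. t \<notin> {0<..<min b d}"
    using ae
  proof eventually_elim
    case (elim t)
    show ?case
    proof
      assume "t \<in> {0<..<min b d}"
      then show False using elim b(2)[of t] by (auto simp: indicator_def)
    qed
  qed
  then have "emeasure lborel {0<..<min b d} = 0"
    by (subst (asm) AE_iff_null_sets[symmetric]) (auto dest: null_setsD1)
  then show False
    using b(1) assms by (simp add: min_def split: if_splits)
qed

text \<open>On \<open>(0, d)\<close> the exponential is at least \<open>exp (- (u * d))\<close>. As
  \<open>d\<close> is arbitrary, the transform decays more slowly than any exponential of fixed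
  rate.\<close>

lemma laplace_ge:
  assumes "d > 0" "u \<ge> 0"
  shows "laplace g u \<ge> exp (- (u * d)) * (\<integral>t. g t * indicator {0<..<d} t \<partial>lborel)"
proof -
  have "exp (- (u * d)) * (\<integral>t. g t * indicator {0<..<d} t \<partial>lborel)
      = (\<integral>t. exp (- (u * d)) * (g t * indicator {0<..<d} t) \<partial>lborel)"
    by simp
  also have "\<dots> \<le> laplace g u"
    unfolding laplace_def
  proof (rule integral_mono)
    show "integrable lborel (\<lambda>t. exp (- (u * d)) * (g t * indicator {0<..<d} t))"
      using integrable by (intro integrable_mult_right integrable_real_mult_indicator) auto
    show "integrable lborel (\<lambda>t. exp (- (u * t)) * g t)"
      using assms zero by (intro integrable_laplace integrable)
    show "exp (- (u * d)) * (g t * indicator {0<..<d} t) \<le> exp (- (u * t)) * g t" for t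
      using assms nonneg[of t]
      by (auto simp: indicator_def intro!: mult_right_mono mult_left_mono)
  qed
  finally show ?thesis .
qed

lemma laplace_pos: "u \<ge> 0 \<Longrightarrow> laplace g u > 0"
  using laplace_ge[of 1 u] integral_initial_pos[of 1]
  by (smt (verit) exp_gt_zero mult_pos_pos)

lemma laplace_antimono:
  assumes "0 \<le> u" "u \<le> \<mu>"
  shows "laplace g \<mu> \<le> laplace g u"
  unfolding laplace_def
proof (rule integral_mono)
  show "integrable lborel (\<lambda>t. exp (- (\<mu> * t)) * g t)"
    "integrable lborel (\<lambda>t. exp (- (u * t)) * g t)"
    using assms zero by (auto intro!: integrable_laplace integrable)
  show "exp (- (\<mu> * t)) * g t \<le> exp (- (u * t)) * g t" for t
    using assms nonneg[of t] zero[of t]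
    by (cases "t < 0") (auto intro!: mult_right_mono)
qed

section \<open>Regular variation of the transform at infinity\<close>

lemma laplace_tail_negligible:
  assumes h: "integrable lborel h" and h0: "\<And>t. t < \<delta> \<Longrightarrow> h t = 0" and "\<delta> > 0"
  shows "((\<lambda>u. laplace h u / laplace g u) \<longlongrightarrow> 0) at_top"
proof -
  \<comment> \<open>Taking half of \<delta> makes the lower bound for \<open>laplace g u\<close> of
    order \<open>exp (- (u * (\<delta> / 2)))\<close>, against \<open>exp (- (u * \<delta>))\<close>
    for \<open>laplace h u\<close>; a decaying factor is left over.\<close>
  define m where "m = (\<integral>t. g t * indicator {0<..<\<delta>/2} t \<partial>lborel)"
  define K where "K = (\<integral>t. \<bar>h t\<bar> \<partial>lborel)"
  have m: "m > 0"
    unfolding m_def using \<open>\<delta> > 0\<close> by (intro integral_initial_pos) simp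
  have upper: "\<bar>laplace h u\<bar> \<le> exp (- (u * \<delta>)) * K" if "u \<ge> 0" for u
  proof -
    have hint: "integrable lborel (\<lambda>t. exp (- (u * t)) * h t)"
      using h h0 \<open>\<delta> > 0\<close> that by (intro integrable_laplace) auto
    have "\<bar>laplace h u\<bar> \<le> (\<integral>t. \<bar>exp (- (u * t)) * h t\<bar> \<partial>lborel)"
      unfolding laplace_def by (rule integral_abs_bound)
    also have "\<dots> \<le> (\<integral>t. exp (- (u * \<delta>)) * \<bar>h t\<bar> \<partial>lborel)"
    proof (rule integral_mono)
      show "\<bar>exp (- (u * t)) * h t\<bar> \<le> exp (- (u * \<delta>)) * \<bar>h t\<bar>" for t
        using h0[of t] that
        by (cases "t < \<delta>") (auto simp: abs_mult intro!: mult_right_mono mult_left_mono)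
    qed (use h hint in auto)
    finally show ?thesis by (simp add: K_def)
  qed
  have lim: "((\<lambda>u. K / m * exp (- (u * (\<delta> / 2)))) \<longlongrightarrow> K / m * 0) at_top"
    using \<open>\<delta> > 0\<close>
    by (intro tendsto_mult tendsto_const filterlim_compose[OF exp_at_bot]
        filterlim_compose[OF filterlim_uminus_at_bot_at_top]
        filterlim_at_top_mult_tendsto_pos[where c="\<delta>/2"] filterlim_ident) auto
  have bound: "\<bar>laplace h u / laplace g u\<bar> \<le> K / m * exp (- (u * (\<delta> / 2)))"
    if "u \<ge> 0" for u
  proof -
    have ge: "laplace g u \<ge> exp (- (u * (\<delta> / 2))) * m"
      unfolding m_def using \<open>\<delta> > 0\<close> that by (intro laplace_ge) auto
    have "\<bar>laplace h u\<bar> / laplace g u \<le> exp (- (u * \<delta>)) * K / (exp (- (u * (\<delta> / 2))) * m)"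
      using upper[OF that] ge m by (intro frac_le) (auto intro: order_trans[OF abs_ge_zero])
    also have "\<dots> = K / m * (exp (- (u * \<delta>)) / exp (- (u * (\<delta> / 2))))"
      by (simp add: mult.commute)
    also have "exp (- (u * \<delta>)) / exp (- (u * (\<delta> / 2))) = exp (- (u * (\<delta> / 2)))"
      by (simp add: exp_diff[symmetric])
    finally show ?thesis using laplace_pos[OF that] by simp
  qed
  have "eventually (\<lambda>u. norm (laplace h u / laplace g u) \<le> K / m * exp (- (u * (\<delta> / 2)))) at_top"
    using eventually_ge_at_top[of 0] by (rule eventually_mono) (simp only: real_norm_def bound)
  from Lim_null_comparison[OF this] lim show ?thesis by simp
qed

text \<open>Substituting \<open>c * t\<close> turns \<open>laplace g (u / c)\<close> into
  \<open>c\<close> times the transform of \<open>g (c * t)\<close>. Near 0 this function is within a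
  factor-controlled error of \<open>c powr \<alpha> * g t\<close>, and the part away from 0 is
  negligible, so the limit is \<open>c * c powr \<alpha>\<close>.\<close>

lemma laplace_ratio:
  assumes "c > 0"
  shows "((\<lambda>u. laplace g (u / c) / laplace g u) \<longlongrightarrow> c powr (\<alpha> + 1)) at_top"
proof (rule tendstoI)
  fix e :: real assume "e > 0"
  \<comment> \<open>The substitution contributes a factor \<open>c\<close>, and there are two
    errors, near 0 and in the tail, each at most \<open>\<epsilon> * laplace g u\<close>.\<close>
  define \<epsilon> where "\<epsilon> = e / (2 * c)"
  have "\<epsilon> > 0" using \<open>e > 0\<close> assms by (simp add: \<epsilon>_def)
  have "eventually (\<lambda>s. \<bar>g (c * s) / g s - c powr \<alpha>\<bar> < \<epsilon>) (at_right 0)"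
    using tendstoD[OF regular[OF assms] \<open>\<epsilon> > 0\<close>] by (simp add: dist_real_def)
  with eventually_pos have "eventually (\<lambda>s. \<bar>g (c * s) - c powr \<alpha> * g s\<bar> \<le> \<epsilon> * g s) (at_right 0)"
  proof eventually_elim
    case (elim s)
    have "g (c * s) - c powr \<alpha> * g s = (g (c * s) / g s - c powr \<alpha>) * g s"
      using elim by (simp add: field_simps)
    then have "\<bar>g (c * s) - c powr \<alpha> * g s\<bar> = \<bar>g (c * s) / g s - c powr \<alpha>\<bar> * g s"
      using elim by (simp add: abs_mult)
    also have "\<dots> \<le> \<epsilon> * g s" using elim by (intro mult_right_mono) auto
    finally show ?case .
  qed
  then obtain \<delta> where \<delta>: "\<delta> > 0"
    "\<And>s. 0 < s \<Longrightarrow> s < \<delta> \<Longrightarrow> \<bar>g (c * s) - c powr \<alpha> * g s\<bar> \<le> \<epsilon> * g s"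
    unfolding eventually_at_right_field by auto
  define D where "D t = g (c * t) - c powr \<alpha> * g t" for t
  define h where "h t = \<bar>D t\<bar> * indicator {\<delta>..} t" for t
  have D_int: "integrable lborel D"
    unfolding D_def using integrable integrable_scaled[OF assms] by auto
  have D0: "D t = 0" if "t < 0" for t
    using zero[of t] zero[of "c * t"] that assms by (simp add: D_def mult_pos_neg)
  have h_int: "integrable lborel h"
    unfolding h_def using D_int by (intro integrable_real_mult_indicator) auto
  have "((\<lambda>u. laplace h u / laplace g u) \<longlongrightarrow> 0) at_top"
    using \<delta>(1) by (intro laplace_tail_negligible[OF h_int]) (auto simp: h_def)
  then have "eventually (\<lambda>u. laplace h u / laplace g u < \<epsilon>) at_top"
    using \<open>\<epsilon> > 0\<close> by (rule order_tendstoD)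
  then show "eventually (\<lambda>u. dist (laplace g (u / c) / laplace g u) (c powr (\<alpha> + 1)) < e) at_top"
    using eventually_gt_at_top[of 0]
  proof eventually_elim
    case (elim u)
    have pos: "laplace g u > 0" using elim by (intro laplace_pos) simp
    have gi: "integrable lborel (\<lambda>t. exp (- (u * t)) * g t)"
      using elim zero by (intro integrable_laplace integrable) auto
    have gci: "integrable lborel (\<lambda>t. exp (- (u * t)) * g (c * t))"
      using elim zero assms by (intro integrable_laplace integrable_scaled) (auto simp: mult_pos_neg)
    have hi: "integrable lborel (\<lambda>t. exp (- (u * t)) * h t)"
      using elim \<delta>(1) by (intro integrable_laplace h_int) (auto simp: h_def)
    have Di: "integrable lborel (\<lambda>t. exp (- (u * t)) * D t)"
      using elim D0 by (intro integrable_laplace D_int) auto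
    have "laplace D u = laplace (\<lambda>t. g (c * t)) u - c powr \<alpha> * laplace g u"
      unfolding laplace_def D_def using gi gci
      by (simp add: right_diff_distrib mult.left_commute[of _ "c powr \<alpha>"])
    then have "laplace g (u / c) - c powr (\<alpha> + 1) * laplace g u = c * laplace D u"
      using assms by (simp add: laplace_scale powr_add right_diff_distrib)
    moreover have "\<bar>laplace D u\<bar> \<le> \<epsilon> * laplace g u + laplace h u"
    proof -
      have "\<bar>laplace D u\<bar> \<le> (\<integral>t. \<bar>exp (- (u * t)) * D t\<bar> \<partial>lborel)"
        unfolding laplace_def by (rule integral_abs_bound)
      also have "\<dots> \<le> (\<integral>t. \<epsilon> * (exp (- (u * t)) * g t) + exp (- (u * t)) * h t \<partial>lborel)"
      proof (rule integral_mono_AE)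
        \<comment> \<open>The estimate from regular variation holds on \<open>(0, \<delta>)\<close>
          only, and \<open>g 0\<close> is arbitrary, so the point 0 is removed as a null
          set.\<close>
        show "AE t in lborel. \<bar>exp (- (u * t)) * D t\<bar>
            \<le> \<epsilon> * (exp (- (u * t)) * g t) + exp (- (u * t)) * h t"
          using AE_lborel_singleton[of 0]
        proof eventually_elim
          case (elim t)
          have "\<bar>D t\<bar> \<le> \<epsilon> * g t + h t"
          proof (cases "t < 0 \<or> t \<ge> \<delta>")
            case True
            then show ?thesis using D0[of t] nonneg[of t] \<open>\<epsilon> > 0\<close>
              by (auto simp: h_def intro!: mult_nonneg_nonneg)
          next
            case False
            then show ?thesis using \<delta>(2)[of t] elim
              by (auto simp: h_def D_def)
          qed
          then have "exp (- (u * t)) * \<bar>D t\<bar> \<le> exp (- (u * t)) * (\<epsilon> * g t + h t)"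
            by (intro mult_left_mono) auto
          then show ?case by (simp add: abs_mult algebra_simps)
        qed
      qed (use gi hi Di in auto)
      also have "\<dots> = \<epsilon> * laplace g u + laplace h u"
        unfolding laplace_def using gi hi by simp
      finally show ?thesis .
    qed
    moreover have "laplace h u < \<epsilon> * laplace g u"
      using elim pos by (simp add: field_simps)
    ultimately have "\<bar>laplace g (u / c) - c powr (\<alpha> + 1) * laplace g u\<bar> < c * (2 * \<epsilon> * laplace g u)"
      using assms by (simp add: abs_mult)
    also have "\<dots> = e * laplace g u" using assms by (simp add: \<epsilon>_def)
    finally have "\<bar>laplace g (u / c) - c powr (\<alpha> + 1) * laplace g u\<bar> / laplace g u < e"
      using pos by (simp add: field_simps)
    moreover have "laplace g (u / c) / laplace g u - c powr (\<alpha> + 1)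
        = (laplace g (u / c) - c powr (\<alpha> + 1) * laplace g u) / laplace g u"
      using pos by (simp add: field_simps)
    ultimately show ?case using pos by (simp add: dist_real_def)
  qed
qed

section \<open>Rescaling by \<open>u\<close> and two-sided bounds for the ratio k\<close>

lemma laplace_rescaled:
  assumes "u > 0"
  shows "laplace (\<lambda>t. g (t / u)) v = u * laplace g (u * v)"
  using laplace_scale[of "1 / u" g v] assms by (simp add: mult.commute)

lemma integrable_rescaled:
  assumes "u > 0" "v \<ge> 0"
  shows "integrable lborel (\<lambda>t. exp (- (v * t)) * g (t / u))"
  using assms zero integrable_scaled[of "1 / u"]
  by (intro integrable_laplace) (auto simp: divide_neg_pos)

lemma regular_at_top:
  assumes "t > 0"
  shows "((\<lambda>u. g (t / u) / g (1 / u)) \<longlongrightarrow> t powr \<alpha>) at_top"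
  using filterlim_compose[OF regular[OF assms] filterlim_inverse_at_right_top]
  by (simp add: field_simps)

lemma eventually_pos_at_top: "eventually (\<lambda>u. g (1 / u) > 0) at_top"
  using filterlim_inverse_at_right_top eventually_pos
  unfolding filterlim_iff by (auto simp: inverse_eq_divide)

text \<open>Dividing \<open>exp (- t) * g (t / u)\<close> by \<open>u * laplace g u\<close> gives
  total mass 1 for \<open>u > 0\<close>; this ratio is the factor
  \<open>g (t / u) / (u * laplace g u)\<close> at \<open>t = 1\<close>.\<close>

definition karamata_ratio :: "real \<Rightarrow> real" where
  "karamata_ratio u = g (1 / u) / (u * laplace g u)"

lemma karamata_ratio_nonneg: "u > 0 \<Longrightarrow> karamata_ratio u \<ge> 0"
  using laplace_pos[of u] nonneg by (simp add: karamata_ratio_def)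

text \<open>The shape with indicator and quotient is that of
  \<open>Gamma_conv_nn_integral_real\<close>.\<close>

abbreviation Gamma_integrand :: "real \<Rightarrow> real" where
  "Gamma_integrand t \<equiv> indicator {0..} t * t powr \<alpha> / exp t"

lemma has_integral_Gamma_integrand:
  "has_bochner_integral lborel Gamma_integrand (Gamma (\<alpha> + 1))"
  using Gamma_conv_nn_integral_real[of "\<alpha> + 1"] alpha Gamma_real_pos[of "\<alpha> + 1"]
  by (intro has_bochner_integral_nn_integral) auto

lemmas integrable_Gamma_integrand = integrable.intros[OF has_integral_Gamma_integrand]
lemmas integral_Gamma_integrand = has_bochner_integral_integral_eq[OF has_integral_Gamma_integrand]

text \<open>The function \<open>f u\<close> below has integral \<open>1 / karamata_ratio u\<close>
  for large \<open>u\<close> and converges almost everywhere to \<open>Gamma_integrand\<close>.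
  Fatou then bounds the lower limit of these integrals by \<open>Gamma (\<alpha> + 1)\<close> from
  below.\<close>

lemma karamata_ratio_upper:
  assumes "y > 1 / Gamma (\<alpha> + 1)"
  shows "eventually (\<lambda>u. karamata_ratio u < y) at_top"
proof -
  have G: "Gamma (\<alpha> + 1) > 0" using alpha by (intro Gamma_real_pos) simp
  then have y: "y > 0" using assms by (smt (verit) divide_pos_pos)
  define f where "f u t = exp (- t) * g (t / u) / g (1 / u)" for u t
  \<comment> \<open>The minimum makes Fatou an instance of dominated convergence, which is available along \<open>at_top\<close>.\<close>
  define m where "m u = (\<integral>t. min (f u t) (Gamma_integrand t) \<partial>lborel)" for u
  have [measurable]: "f u \<in> borel_measurable borel" for u
    unfolding f_def by measurable
  have "(m \<longlongrightarrow> (\<integral>t. Gamma_integrand t \<partial>lborel)) at_top"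
    unfolding m_def
  proof (rule integral_dominated_convergence_at_top)
    show "eventually (\<lambda>u. AE t in lborel. norm (min (f u t) (Gamma_integrand t)) \<le> Gamma_integrand t) at_top"
      by (intro always_eventually allI AE_I2) (auto simp: f_def nonneg min_def)
    show "AE t in lborel. ((\<lambda>u. min (f u t) (Gamma_integrand t)) \<longlongrightarrow> Gamma_integrand t) at_top"
      using AE_lborel_singleton[of 0]
    proof eventually_elim
      case (elim t)
      have "((\<lambda>u. f u t) \<longlongrightarrow> Gamma_integrand t) at_top"
      proof (cases "t > 0")
        case True
        have "((\<lambda>u. exp (- t) * (g (t / u) / g (1 / u))) \<longlongrightarrow> exp (- t) * t powr \<alpha>) at_top"
          by (intro tendsto_intros regular_at_top True)
        then show ?thesis using True by (simp add: f_def exp_minus field_simps)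
      next
        case False
        then have "t < 0" using elim by simp
        have "eventually (\<lambda>u. 0 = f u t) at_top"
          using eventually_gt_at_top[of 0]
          by eventually_elim (use zero \<open>t < 0\<close> in \<open>auto simp: f_def divide_neg_pos\<close>)
        then show ?thesis using \<open>t < 0\<close> by (auto intro: Lim_transform_eventually)
      qed
      from tendsto_min[OF this tendsto_const[of "Gamma_integrand t"]] show ?case by simp
    qed
  qed (use integrable_Gamma_integrand in auto)
  then have "eventually (\<lambda>u. m u > 1 / y) at_top"
    using assms y G unfolding integral_Gamma_integrand
    by (intro order_tendstoD(1)) (auto simp: field_simps)
  then show ?thesis
    using eventually_pos_at_top eventually_gt_at_top[of 0]
  proof eventually_elim
    case (elim u)
    have fi: "integrable lborel (f u)"
      unfolding f_def using integrable_rescaled[of u 1] elim by (intro integrable_divide) auto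
    have "m u \<le> integral\<^sup>L lborel (f u)"
      unfolding m_def using fi integrable_Gamma_integrand by (intro integral_mono integrable_min) auto
    also have "\<dots> = laplace (\<lambda>t. g (t / u)) 1 / g (1 / u)"
      unfolding laplace_def f_def by simp
    also have "\<dots> = 1 / karamata_ratio u"
      using elim by (simp add: laplace_rescaled karamata_ratio_def)
    finally have "1 / y < 1 / karamata_ratio u" using elim by simp
    moreover have "karamata_ratio u > 0"
      unfolding karamata_ratio_def using elim laplace_pos[of u] by auto
    ultimately show ?case using y by (simp add: field_simps)
  qed
qed

text \<open>Convergence of k is not yet known, so \<open>karamata_ratio u * t powr \<alpha>\<close>
  stands in for a limit. The bracket is k(u) times
  \<open>g (t / u) / g (1 / u) - t powr \<alpha>\<close> once \<open>g (1 / u) > 0\<close>; it tends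
  to 0 pointwise because k is eventually bounded.\<close>

lemma karamata_ratio_average:
  assumes "0 < a" "a < b"
  shows "((\<lambda>u. \<integral>t. indicator {a..b} t * exp (- t) *
      (g (t / u) / (u * laplace g u) - karamata_ratio u * t powr \<alpha>) \<partial>lborel) \<longlongrightarrow> 0) at_top"
proof -
  define C where "C = 1 / Gamma (\<alpha> + 1) + 1"
  have "eventually (\<lambda>u. karamata_ratio u < C) at_top"
    by (intro karamata_ratio_upper) (simp add: C_def)
  then have ev: "eventually (\<lambda>u. u > 0 \<and> 0 \<le> karamata_ratio u \<and> karamata_ratio u \<le> C) at_top"
    using eventually_gt_at_top[of 0]
    by eventually_elim (auto intro: karamata_ratio_nonneg)
  then obtain N where N: "\<And>u. u \<ge> N \<Longrightarrow> u > 0 \<and> 0 \<le> karamata_ratio u \<and> karamata_ratio u \<le> C"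
    unfolding eventually_at_top_linorder by blast
  have "C \<ge> 0" using N[of N] by auto
  \<comment> \<open>Bounds \<open>g (t / u) / (u * laplace g u)\<close> on \<open>{a..b}\<close>:
    \<open>C / a\<close> comes from \<open>karamata_ratio (u / t) / t\<close>, the other factor from
    the quotient of transforms.\<close>
  define B where "B = C / a * (b powr (\<alpha> + 1) + 1)"
  define F where "F u t = indicator {a..b} t * exp (- t) *
      (g (t / u) / (u * laplace g u) - karamata_ratio u * t powr \<alpha>)" for u t
  have [measurable]: "F u \<in> borel_measurable borel" for u
    unfolding F_def by measurable
  have "((\<lambda>u. integral\<^sup>L lborel (F u)) \<longlongrightarrow> integral\<^sup>L lborel (\<lambda>t::real. 0::real)) at_top"
  proof (rule integral_dominated_convergence_at_top)
    show "integrable lborel (\<lambda>t. B * indicator {a..b} t + C * Gamma_integrand t)"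
      using integrable_Gamma_integrand
      by (intro Bochner_Integration.integrable_add integrable_mult_right integrable_real_indicator)
        (auto simp: emeasure_lborel_Icc_eq)
    have "eventually (\<lambda>u. laplace g (u / b) / laplace g u < b powr (\<alpha> + 1) + 1) at_top"
      using assms by (intro order_tendstoD(2)[OF laplace_ratio]) auto
    then show "eventually (\<lambda>u. AE t in lborel. norm (F u t)
        \<le> B * indicator {a..b} t + C * Gamma_integrand t) at_top"
      using eventually_ge_at_top[of N] eventually_ge_at_top[of "N * b"]
    proof eventually_elim
      case (elim u)
      have u: "u > 0" using N[of u] elim by simp
      have pos: "laplace g u > 0" using u by (intro laplace_pos) simp
      show ?case
      proof (rule AE_I2)
        fix t :: real
        show "norm (F u t) \<le> B * indicator {a..b} t + C * Gamma_integrand t"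
        proof (cases "t \<in> {a..b}")
          case False
          then show ?thesis using \<open>C \<ge> 0\<close> by (auto simp: F_def)
        next
          case True
          have t: "t > 0" using True assms by simp
          have "N > 0" using N[of N] by simp
          \<comment> \<open>With \<open>u \<ge> N * b\<close> the bound \<open>C\<close> for k is
            available at \<open>u / t\<close> for every \<open>t \<le> b\<close> at once.\<close>
          have "u / t \<ge> N"
          proof -
            have "N * t \<le> N * b" using True \<open>N > 0\<close> by (intro mult_left_mono) auto
            then show ?thesis using elim t by (simp add: field_simps)
          qed
          have ut: "laplace g (u / t) > 0" using t u by (intro laplace_pos) simp
          \<comment> \<open>Since \<open>t / u\<close> is the reciprocal of \<open>u / t\<close>,
            the density is expressed by k at \<open>u / t\<close>. Only monotonicity of the
            transform is then needed for a bound uniform in \<open>t\<close>.\<close>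
          have "g (t / u) / (u * laplace g u)
              = karamata_ratio (u / t) / t * (laplace g (u / t) / laplace g u)"
            using t u ut by (simp add: karamata_ratio_def field_simps)
          also have "\<dots> \<le> C / a * (b powr (\<alpha> + 1) + 1)"
          proof (intro mult_mono frac_le)
            have "laplace g (u / t) \<le> laplace g (u / b)"
              using True t u assms by (intro laplace_antimono frac_le) auto
            then have "laplace g (u / t) / laplace g u \<le> laplace g (u / b) / laplace g u"
              using pos by (intro divide_right_mono) auto
            then show "laplace g (u / t) / laplace g u \<le> b powr (\<alpha> + 1) + 1"
              using elim by simp
          qed (use N[OF \<open>u / t \<ge> N\<close>] True assms \<open>C \<ge> 0\<close> pos ut in auto)
          finally have 1: "g (t / u) / (u * laplace g u) \<le> B" by (simp add: B_def)
          have 2: "0 \<le> g (t / u) / (u * laplace g u)" using u pos nonneg by simp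
          have 3: "exp (- t) * (g (t / u) / (u * laplace g u)) \<le> B"
            using mult_mono[of "exp (- t)" 1 "g (t / u) / (u * laplace g u)" B] 1 2 t by simp
          have 4: "0 \<le> exp (- t) * (g (t / u) / (u * laplace g u))"
            using 2 by (intro mult_nonneg_nonneg) auto
          have 5: "exp (- t) * (karamata_ratio u * t powr \<alpha>) \<le> C * Gamma_integrand t"
            using N[of u] elim t
            by (auto simp: exp_minus field_simps intro!: mult_right_mono)
          have 6: "0 \<le> exp (- t) * (karamata_ratio u * t powr \<alpha>)"
            using N[of u] elim by simp
          have "F u t = exp (- t) * (g (t / u) / (u * laplace g u))
              - exp (- t) * (karamata_ratio u * t powr \<alpha>)"
            using True by (simp add: F_def right_diff_distrib)
          then show ?thesis using 3 4 5 6 True by simp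
        qed
      qed
    qed
    show "AE t in lborel. ((\<lambda>u. F u t) \<longlongrightarrow> 0) at_top"
    proof (rule AE_I2)
      fix t :: real
      show "((\<lambda>u. F u t) \<longlongrightarrow> 0) at_top"
      proof (cases "t \<in> {a..b}")
        case False
        then show ?thesis by (simp add: F_def)
      next
        case True
        then have t: "t > 0" using assms by simp
        have "((\<lambda>u. C * \<bar>g (t / u) / g (1 / u) - t powr \<alpha>\<bar>) \<longlongrightarrow> C * \<bar>t powr \<alpha> - t powr \<alpha>\<bar>) at_top"
          by (intro tendsto_intros regular_at_top t)
        then have lim: "((\<lambda>u. C * \<bar>g (t / u) / g (1 / u) - t powr \<alpha>\<bar>) \<longlongrightarrow> 0) at_top"
          by simp
        have "eventually (\<lambda>u. norm (F u t) \<le> C * \<bar>g (t / u) / g (1 / u) - t powr \<alpha>\<bar>) at_top"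
          using ev eventually_pos_at_top
        proof eventually_elim
          case (elim u)
          have "F u t = exp (- t) * (karamata_ratio u * (g (t / u) / g (1 / u) - t powr \<alpha>))"
            using True elim by (simp add: F_def karamata_ratio_def right_diff_distrib)
          then have "norm (F u t) = exp (- t) * (karamata_ratio u * \<bar>g (t / u) / g (1 / u) - t powr \<alpha>\<bar>)"
            using elim by (simp add: abs_mult)
          also have "\<dots> \<le> 1 * (C * \<bar>g (t / u) / g (1 / u) - t powr \<alpha>\<bar>)"
            using elim t by (intro mult_mono) auto
          finally show ?case by simp
        qed
        then show ?thesis using lim by (rule Lim_null_comparison)
      qed
    qed
  qed auto
  then show ?thesis by (simp add: F_def[abs_def])
qed

text \<open>The rescaled measure has mass 1. Up to \<open>J u\<close>, its mass on
  \<open>{a..b}\<close> is at most \<open>karamata_ratio u * Gamma (\<alpha> + 1)\<close>; if the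
  mass outside is small, k cannot be much below \<open>1 / Gamma (\<alpha> + 1)\<close>.\<close>

lemma karamata_ratio_lower:
  assumes "y < 1 / Gamma (\<alpha> + 1)"
  shows "eventually (\<lambda>u. karamata_ratio u > y) at_top"
proof -
  have G: "Gamma (\<alpha> + 1) > 0" using alpha by (intro Gamma_real_pos) simp
  define \<beta> where "\<beta> = \<alpha> + 1"
  have "\<beta> > 0" using alpha by (simp add: \<beta>_def)
  \<comment> \<open>The two terms are the limits of the mass bounds on \<open>(0, 1 / x)\<close> and
    \<open>(x, \<infinity>)\<close>. Setting \<open>a = 1 / b\<close> lets a single parameter
    control both ends.\<close>
  have "((\<lambda>x. exp 1 * (1 / x) powr \<beta> + exp (- x / 2) * 2 powr \<beta>) \<longlongrightarrow> 0) at_top"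
    using \<open>\<beta> > 0\<close> by real_asymp
  moreover have "1 - y * Gamma (\<alpha> + 1) > 0" using assms G by (simp add: field_simps)
  ultimately have "eventually (\<lambda>x. exp 1 * (1 / x) powr \<beta> + exp (- x / 2) * 2 powr \<beta>
      < 1 - y * Gamma (\<alpha> + 1)) at_top"
    by (rule order_tendstoD)
  then have "eventually (\<lambda>x. x > 1 \<and> exp 1 * (1 / x) powr \<beta> + exp (- x / 2) * 2 powr \<beta>
      < 1 - y * Gamma (\<alpha> + 1)) at_top"
    using eventually_gt_at_top[of 1] by eventually_elim auto
  then obtain b where b: "b > 1" "exp 1 * (1 / b) powr \<beta> + exp (- b / 2) * 2 powr \<beta>
      < 1 - y * Gamma (\<alpha> + 1)"
    using eventually_happens trivial_limit_at_top_linorder by blast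
  define a where "a = 1 / b"
  have ab: "0 < a" "a < b" using b(1) by (auto simp: a_def field_simps)
      (smt (verit) mult_less_cancel_left2)
  define J where "J u = (\<integral>t. indicator {a..b} t * exp (- t) *
      (g (t / u) / (u * laplace g u) - karamata_ratio u * t powr \<alpha>) \<partial>lborel)" for u
  have "((\<lambda>u. J u + exp 1 * (laplace g (u / a) / laplace g u)
      + exp (- b / 2) * (laplace g (u / 2) / laplace g u))
      \<longlongrightarrow> 0 + exp 1 * a powr \<beta> + exp (- b / 2) * 2 powr \<beta>) at_top"
    unfolding J_def \<beta>_def using ab
    by (intro tendsto_intros karamata_ratio_average laplace_ratio) auto
  then have "eventually (\<lambda>u. J u + exp 1 * (laplace g (u / a) / laplace g u)
      + exp (- b / 2) * (laplace g (u / 2) / laplace g u) < 1 - y * Gamma (\<alpha> + 1)) at_top"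
    using b(2) by (intro order_tendstoD(2)) (auto simp: a_def)
  then show ?thesis
    using eventually_gt_at_top[of 0]
  proof eventually_elim
    case (elim u)
    define q where "q = u * laplace g u"
    have q: "q > 0" using elim laplace_pos[of u] by (simp add: q_def)
    \<comment> \<open>\<open>P 1\<close> is the normalised density; \<open>P (1 / a)\<close> and
      \<open>P (1 / 2)\<close> dominate it near 0 and near infinity up to constants, and their
      integrals are quotients of transforms.\<close>
    define P where "P v t = exp (- (v * t)) * g (t / u) / q" for v t
    have Pi: "integrable lborel (P v)" if "v \<ge> 0" for v
      unfolding P_def using integrable_rescaled[of u v] elim that by (intro integrable_divide) auto
    have P_int: "integral\<^sup>L lborel (P v) = laplace g (u * v) / laplace g u" for v
    proof -
      have "integral\<^sup>L lborel (P v) = laplace (\<lambda>t. g (t / u)) v / q"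
        by (simp add: P_def[abs_def] laplace_def)
      then show ?thesis using elim by (simp add: laplace_rescaled q_def)
    qed
    have P_nonneg: "P v t \<ge> 0" for v t using q nonneg by (simp add: P_def)
    have Wi: "integrable lborel (\<lambda>t. indicator {a..b} t * exp (- t) * t powr \<alpha>)"
    proof (rule Bochner_Integration.integrable_bound[OF integrable_Gamma_integrand])
      show "AE t in lborel. norm (indicator {a..b} t * exp (- t) * t powr \<alpha>) \<le> norm (Gamma_integrand t)"
        using ab by (intro AE_I2) (auto simp: indicator_def exp_minus field_simps)
    qed simp
    have Ii: "integrable lborel (\<lambda>t. indicator {a..b} t * P 1 t)"
      using integrable_real_mult_indicator[OF _ Pi[of 1], of "{a..b}"] by (simp add: mult.commute)
    have "1 = integral\<^sup>L lborel (P 1)"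
      using elim laplace_pos[of u] by (simp add: P_int)
    also have "\<dots> \<le> (\<integral>t. indicator {a..b} t * P 1 t + exp 1 * P (1 / a) t
        + exp (- b / 2) * P (1 / 2) t \<partial>lborel)"
    proof (rule integral_mono)
      fix t :: real
      show "P 1 t \<le> indicator {a..b} t * P 1 t + exp 1 * P (1 / a) t + exp (- b / 2) * P (1 / 2) t"
      proof -
        have *: "exp s * P v t = exp (s - v * t) * g (t / u) / q" for s v
          by (simp add: P_def exp_diff exp_minus divide_inverse)
        have nn: "exp 1 * P (1 / a) t \<ge> 0" "exp (- b / 2) * P (1 / 2) t \<ge> 0"
          using P_nonneg by auto
        consider "t < 0" | "0 \<le> t" "t < a" | "t \<in> {a..b}" | "t > b"
          by fastforce
        then show ?thesis
        proof cases
          case 1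
          then have "g (t / u) = 0" using elim by (intro zero) (simp add: divide_neg_pos)
          then show ?thesis by (simp add: P_def)
        next
          case 2
          \<comment> \<open>For \<open>0 \<le> t < a\<close> the right exponent is positive and the
            left one is at most 0.\<close>
          then have "exp (- (1 * t)) \<le> exp (1 - 1 / a * t)" using ab
            by (simp add: field_simps) (smt (verit) mult_nonneg_nonneg)
          then have "P 1 t \<le> exp 1 * P (1 / a) t"
            unfolding * using nonneg q
            by (auto simp: P_def intro!: divide_right_mono mult_right_mono)
          then show ?thesis using 2 nn by simp
        next
          case 3
          then show ?thesis using P_nonneg[of "1 / 2" t] P_nonneg[of "1 / a" t] by simp
        next
          case 4
          \<comment> \<open>Half of the exponent is spent on \<open>t > b\<close>, which gives
            \<open>exp (- b / 2)\<close>; the other half stays in \<open>P (1 / 2)\<close>.\<close>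
          then have "P 1 t \<le> exp (- b / 2) * P (1 / 2) t"
            unfolding * using nonneg q ab
            by (auto simp: P_def intro!: divide_right_mono mult_right_mono)
          then show ?thesis using 4 nn by simp
        qed
      qed
    qed (use Pi Ii ab in \<open>auto intro!: Bochner_Integration.integrable_add integrable_mult_right\<close>)
    also have "\<dots> = (\<integral>t. indicator {a..b} t * P 1 t \<partial>lborel)
        + exp 1 * (laplace g (u / a) / laplace g u) + exp (- b / 2) * (laplace g (u / 2) / laplace g u)"
      using Pi Ii ab by (simp add: P_int)
    also have "(\<integral>t. indicator {a..b} t * P 1 t \<partial>lborel)
        = J u + karamata_ratio u * (\<integral>t. indicator {a..b} t * exp (- t) * t powr \<alpha> \<partial>lborel)"
    proof -
      have "J u = (\<integral>t. indicator {a..b} t * P 1 t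
          - karamata_ratio u * (indicator {a..b} t * exp (- t) * t powr \<alpha>) \<partial>lborel)"
        unfolding J_def by (intro Bochner_Integration.integral_cong) (simp_all add: P_def q_def algebra_simps)
      then show ?thesis using Ii Wi by simp
    qed
    also have "(\<integral>t. indicator {a..b} t * exp (- t) * t powr \<alpha> \<partial>lborel) \<le> Gamma (\<alpha> + 1)"
      unfolding integral_Gamma_integrand[symmetric]
      using Wi integrable_Gamma_integrand ab
      by (intro integral_mono) (auto simp: indicator_def exp_minus field_simps)
    finally have "1 \<le> J u + karamata_ratio u * Gamma (\<alpha> + 1)
        + exp 1 * (laplace g (u / a) / laplace g u) + exp (- b / 2) * (laplace g (u / 2) / laplace g u)"
      using karamata_ratio_nonneg[of u] elim by (simp add: mult_left_mono)
    then have "y * Gamma (\<alpha> + 1) < karamata_ratio u * Gamma (\<alpha> + 1)"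
      using elim by simp
    then show ?case using G by simp
  qed
qed

text \<open>The one-sided bounds give the limit of k, and the quotient here is its
  reciprocal.\<close>

theorem laplace_asymptotics:
  "((\<lambda>u. u * laplace g u / g (1 / u)) \<longlongrightarrow> Gamma (\<alpha> + 1)) at_top"
proof -
  have G: "Gamma (\<alpha> + 1) > 0" using alpha by (intro Gamma_real_pos) simp
  have "(karamata_ratio \<longlongrightarrow> 1 / Gamma (\<alpha> + 1)) at_top"
    by (intro order_tendstoI karamata_ratio_lower karamata_ratio_upper)
  from tendsto_inverse[OF this] show ?thesis
    using G by (simp add: karamata_ratio_def)
qed

end

section \<open>The characteristic function of the Gaussian mixture\<close>

lemma char_gaussian_mixture:
  fixes X S :: "'a \<Rightarrow> real"
  assumes "prob_space M"
    and X: "distributed M lborel X (\<lambda>x. ennreal (std_normal_density x))"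
    and indep: "prob_space.indep_var M borel X borel S"
    and nonneg: "AE \<omega> in M. S \<omega> \<ge> 0"
  shows "char (distr M borel (\<lambda>\<omega>. w * sqrt (S \<omega>) * X \<omega>)) t
    = complex_of_real (\<integral>\<omega>. exp (- (t\<^sup>2 * w\<^sup>2 / 2 * S \<omega>)) \<partial>M)"
proof -
  interpret prob_space M by fact
  have [measurable]: "random_variable borel X" "random_variable borel S"
    and prod: "distr M borel X \<Otimes>\<^sub>M distr M borel S
      = distr M (borel \<Otimes>\<^sub>M borel) (\<lambda>\<omega>. (X \<omega>, S \<omega>))"
    using indep unfolding indep_var_distribution_eq by auto
  interpret DX: prob_space "distr M borel X" by (rule prob_space_distr) simp
  interpret DS: prob_space "distr M borel S" by (rule prob_space_distr) simp
  interpret P: pair_prob_space "distr M borel X" "distr M borel S" ..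
  \<comment> \<open>Independence is stated over \<open>borel\<close> and the density over
    \<open>lborel\<close>; the measurable sets agree.\<close>
  have "distr M borel X = distr M lborel X"
    by (intro distr_cong) simp_all
  then have DX: "distr M borel X = std_normal_distribution"
    using X by (simp add: distributed_def)
  define f :: "real \<Rightarrow> real \<Rightarrow> complex" where "f x s = iexp (t * (w * sqrt s * x))" for x s
  have [measurable]: "case_prod f \<in> borel_measurable (borel \<Otimes>\<^sub>M borel)"
    unfolding f_def by measurable
  have int: "integrable (distr M borel X \<Otimes>\<^sub>M distr M borel S) (case_prod f)"
    by (intro P.integrable_const_bound[of _ 1]) (auto simp: f_def)
  have "char (distr M borel (\<lambda>\<omega>. w * sqrt (S \<omega>) * X \<omega>)) t = (\<integral>\<omega>. f (X \<omega>) (S \<omega>) \<partial>M)"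
    unfolding char_def f_def by (subst integral_distr) auto
  also have "\<dots> = integral\<^sup>L (distr M (borel \<Otimes>\<^sub>M borel) (\<lambda>\<omega>. (X \<omega>, S \<omega>))) (case_prod f)"
    by (subst integral_distr) auto
  \<comment> \<open>Conditioning on \<open>S\<close>: by independence the joint law is a product,
    and Fubini integrates \<open>x\<close> first. The inner integral is the standard normal
    characteristic function at \<open>t * w * sqrt s\<close>.\<close>
  also have "\<dots> = (\<integral>s. (\<integral>x. f x s \<partial>distr M borel X) \<partial>distr M borel S)"
    unfolding prod[symmetric] P.integral_snd[OF int] ..
  also have "\<dots> = (\<integral>s. complex_of_real (exp (- (t * w * sqrt s)\<^sup>2 / 2)) \<partial>distr M borel S)"
  proof -
    have "(\<integral>x. f x s \<partial>distr M borel X) = char std_normal_distribution (t * w * sqrt s)" for s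
      unfolding DX char_def f_def by (simp add: mult.assoc)
    then show ?thesis by (simp add: char_std_normal_distribution)
  qed
  also have "\<dots> = complex_of_real (\<integral>\<omega>. exp (- (t * w * sqrt (S \<omega>))\<^sup>2 / 2) \<partial>M)"
    unfolding integral_complex_of_real by (subst integral_distr) auto
  also have "(\<integral>\<omega>. exp (- (t * w * sqrt (S \<omega>))\<^sup>2 / 2) \<partial>M) = (\<integral>\<omega>. exp (- (t\<^sup>2 * w\<^sup>2 / 2 * S \<omega>)) \<partial>M)"
    using nonneg by (intro integral_cong_AE) (auto simp: power_mult_distrib elim!: eventually_mono)
  finally show ?thesis .
qed

lemma (in prob_space) expectation_exp_pos:
  fixes Y :: "'a \<Rightarrow> real"
  assumes [measurable]: "random_variable borel Y" and "AE \<omega> in M. Y \<omega> \<ge> 0"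
  shows "expectation (\<lambda>\<omega>. exp (- Y \<omega>)) > 0"
proof (rule ccontr)
  have int: "integrable M (\<lambda>\<omega>. exp (- Y \<omega>))"
    using assms(2) by (intro integrable_const_bound[of _ 1]) auto
  assume "\<not> ?thesis"
  moreover have "expectation (\<lambda>\<omega>. exp (- Y \<omega>)) \<ge> 0" by simp
  ultimately have "expectation (\<lambda>\<omega>. exp (- Y \<omega>)) = 0" by simp
  then show False
    using integral_nonneg_eq_0_iff_AE[OF int] by simp
qed

section \<open>From slow variation of \<open>L\<close> to regular variation of the density\<close>

lemma slowly_varying_eventually_nonzero:
  assumes "slowly_varying_at_0 L"
  shows "eventually (\<lambda>s. L s \<noteq> 0) (at_right 0)"
proof -
  \<comment> \<open>As for \<open>g\<close>, the case \<open>c = 1\<close> excludes zeros because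
    division by 0 yields 0.\<close>
  have "((\<lambda>s. L (1 * s) / L s) \<longlongrightarrow> 1) (at_right 0)"
    using assms zero_less_one unfolding slowly_varying_at_0_def by blast
  then have "eventually (\<lambda>s. L (1 * s) / L s > 0) (at_right 0)"
    by (rule order_tendstoD) simp
  then show ?thesis by eventually_elim auto
qed

text \<open>Near 0, \<open>f s\<close> is \<open>a s * L s * s powr \<alpha>\<close> with
  \<open>a\<close> tending to 1, so the ratio splits into factors with limits 1, 1 and
  \<open>c powr \<alpha>\<close>. Cancelling requires \<open>L\<close> to be nonzero at both
  \<open>s\<close> and \<open>c * s\<close>.\<close>

lemma regularly_varying_of_slowly_varying:
  assumes L: "slowly_varying_at_0 L"
    and A: "((\<lambda>s. f s / (L s * s powr \<alpha>)) \<longlongrightarrow> 1) (at_right 0)"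
    and c: "c > 0"
  shows "((\<lambda>s. f (c * s) / f s) \<longlongrightarrow> c powr \<alpha>) (at_right 0)"
proof -
  define a where "a s = f s / (L s * s powr \<alpha>)" for s
  have scale: "filterlim (\<lambda>s. c * s) (at_right 0) (at_right 0)"
    using c by real_asymp
  have a: "(a \<longlongrightarrow> 1) (at_right 0)" using A by (simp add: a_def[abs_def])
  have "((\<lambda>s. a (c * s) / a s * (L (c * s) / L s) * c powr \<alpha>) \<longlongrightarrow> 1 / 1 * 1 * c powr \<alpha>) (at_right 0)"
    using L c unfolding slowly_varying_at_0_def
    by (intro tendsto_intros a filterlim_compose[OF a scale]) auto
  moreover have "eventually (\<lambda>s. a (c * s) / a s * (L (c * s) / L s) * c powr \<alpha> = f (c * s) / f s) (at_right 0)"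
    using slowly_varying_eventually_nonzero[OF L]
      eventually_compose_filterlim[OF slowly_varying_eventually_nonzero[OF L] scale]
      eventually_at_right_less[of 0]
  proof eventually_elim
    case (elim s)
    then show ?case using c by (simp add: a_def powr_mult)
  qed
  ultimately show ?thesis by (simp add: tendsto_cong)
qed

section \<open>Passage from the Laplace transform to the limit of \<open>l_theta\<close>\<close>

theorem proposition12:
  fixes M :: "'a measure" and X S :: "'a \<Rightarrow> real"
    and \<rho> L :: "real \<Rightarrow> real" and \<theta> \<sigma>0 \<alpha> :: real
  assumes "prob_space M"
    and "\<theta> \<noteq> 0"
    and "distributed M lborel X (\<lambda>x. ennreal (std_normal_density x))"
    and "prob_space.indep_var M borel X borel S"
    and "\<And>x. x \<ge> \<sigma>0\<^sup>2 \<Longrightarrow> \<rho> x \<ge> 0"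
    and "distributed M lborel S (\<lambda>x. ennreal (\<rho> x * indicator {\<sigma>0\<^sup>2..} x))"
    and "\<alpha> > -1"
    and "slowly_varying_at_0 L"
    and "(\<lambda>s. \<rho> (\<sigma>0\<^sup>2 + s)) \<sim>[at_right 0] (\<lambda>s. L s * s powr \<alpha>)"
  shows "(\<forall>w. real_positive_char M (\<lambda>\<omega>. w * sqrt (S \<omega>) * X \<omega>)) \<and>
    ((\<lambda>w. l_theta M \<theta> (\<lambda>\<omega>. w * sqrt (S \<omega>) * X \<omega>) - w\<^sup>2 * \<sigma>0\<^sup>2
        - 2 / \<theta>\<^sup>2 * (2 * (1 + \<alpha>) * ln w - ln (Gamma (1 + \<alpha>) * L (1 / w\<^sup>2))
                     + (1 + \<alpha>) * ln (\<theta>\<^sup>2 / 2))) \<longlongrightarrow> 0) at_top"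
proof
  interpret prob_space M by fact
  note rho = assms(5) and dS = assms(6) and L = assms(8)
  \<comment> \<open>The sign of \<rho> is known only on the half-line, so it is cut off before being
    shifted to the origin as \<open>g\<close>.\<close>
  define d where "d x = \<rho> x * indicator {\<sigma>0\<^sup>2..} x" for x
  define g where "g s = d (\<sigma>0\<^sup>2 + s)" for s
  have d_nonneg: "d x \<ge> 0" for x using rho[of x] by (auto simp: d_def indicator_def)
  have dS': "distributed M lborel S (\<lambda>x. ennreal (d x))" using dS by (simp add: d_def)
  have [measurable]: "random_variable borel S"
    using distributed_measurable[OF dS'] by simp
  have "AE x in distr M lborel S. x \<ge> \<sigma>0\<^sup>2"
    unfolding distributed_distr_eq_density[OF dS']
    using distributed_borel_measurable[OF dS']
    by (subst AE_density) (auto simp: d_def indicator_def)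
  then have S_ge: "AE \<omega> in M. S \<omega> \<ge> \<sigma>0\<^sup>2"
    using distributed_measurable[OF dS'] by (rule AE_distrD[rotated])
  then have S_nonneg: "AE \<omega> in M. S \<omega> \<ge> 0"
    by eventually_elim (rule order_trans[OF zero_le_power2])
  have char: "char (distr M borel (\<lambda>\<omega>. w * sqrt (S \<omega>) * X \<omega>)) t
      = complex_of_real (expectation (\<lambda>\<omega>. exp (- (t\<^sup>2 * w\<^sup>2 / 2 * S \<omega>))))" for w t
    by (rule char_gaussian_mixture) (use assms S_nonneg in auto)
  have "expectation (\<lambda>\<omega>. exp (- (t\<^sup>2 * w\<^sup>2 / 2 * S \<omega>))) > 0" for w t
    using S_nonneg by (intro expectation_exp_pos) auto
  then show "\<forall>w. real_positive_char M (\<lambda>\<omega>. w * sqrt (S \<omega>) * X \<omega>)"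
    unfolding real_positive_char_def char by blast

  have "integrable lborel d"
    using distributed_integrable[OF dS', of "\<lambda>_. 1"] d_nonneg by simp
  then have g_int: "integrable lborel g"
    using lborel_integrable_real_affine[of d 1 "\<sigma>0\<^sup>2"] by (simp add: g_def[abs_def])
  \<comment> \<open>Shifting by \<open>\<sigma>0\<^sup>2\<close> splits off the exponential factor
    whose logarithm produces the term \<open>w\<^sup>2 * \<sigma>0\<^sup>2\<close>.\<close>
  have expectation: "expectation (\<lambda>\<omega>. exp (- (c * S \<omega>))) = exp (- (c * \<sigma>0\<^sup>2)) * laplace g c" for c
  proof -
    have "expectation (\<lambda>\<omega>. exp (- (c * S \<omega>))) = (\<integral>x. d x * exp (- (c * x)) \<partial>lborel)"
      using distributed_integral[OF dS', of "\<lambda>x. exp (- (c * x))"] d_nonneg by simp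
    also have "\<dots> = (\<integral>s. exp (- (c * \<sigma>0\<^sup>2)) * (exp (- (c * s)) * g s) \<partial>lborel)"
      by (subst lborel_integral_real_affine[of 1 _ "\<sigma>0\<^sup>2"])
        (simp_all add: g_def distrib_left exp_add[symmetric] mult.assoc[symmetric] mult.commute exp_diff exp_minus field_simps)
    finally show ?thesis by (simp add: laplace_def)
  qed

  \<comment> \<open>Asymptotic equivalence counts 0 / 0 as 1; the plain quotient has limit 1 because
    \<open>L s * s powr \<alpha>\<close> is nonzero near 0.\<close>
  have "((\<lambda>s. \<rho> (\<sigma>0\<^sup>2 + s) / (L s * s powr \<alpha>)) \<longlongrightarrow> 1) (at_right 0)"
    using slowly_varying_eventually_nonzero[OF L] eventually_at_right_less[of 0]
    by (intro asymp_equivD_strong assms) (auto elim: eventually_elim2)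
  moreover have "eventually (\<lambda>s. \<rho> (\<sigma>0\<^sup>2 + s) / (L s * s powr \<alpha>) = g s / (L s * s powr \<alpha>)) (at_right 0)"
    using eventually_at_right_less[of 0] by eventually_elim (simp add: g_def d_def)
  ultimately have A: "((\<lambda>s. g s / (L s * s powr \<alpha>)) \<longlongrightarrow> 1) (at_right 0)"
    by (simp add: tendsto_cong)
  interpret regularly_varying_density g \<alpha>
    by standard (use g_int d_nonneg \<open>\<alpha> > -1\<close> regularly_varying_of_slowly_varying[OF L A]
      in \<open>auto simp: g_def d_def\<close>)

  define u where "u w = \<theta>\<^sup>2 * w\<^sup>2 / 2" for w
  \<comment> \<open>Eventually \<open>Q w\<close> is \<open>laplace g (u w)\<close> divided by
    \<open>Gamma (1 + \<alpha>) * L (1 / w\<^sup>2) * u w powr (- (1 + \<alpha>))\<close>. The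
    factor with two values of \<open>L\<close> moves its argument from \<open>1 / u w\<close> to
    \<open>1 / w\<^sup>2\<close> by slow variation. The error in the theorem is exactly
    \<open>- (2 / \<theta>\<^sup>2) * ln (Q w)\<close> for large \<open>w\<close>.\<close>
  define Q where "Q w = u w * laplace g (u w) / g (1 / u w) * (g (1 / u w) / (L (1 / u w) * (1 / u w) powr \<alpha>))
    * (L (2 / \<theta>\<^sup>2 * (1 / w\<^sup>2)) / L (1 / w\<^sup>2)) / Gamma (1 + \<alpha>)" for w
  have G: "Gamma (1 + \<alpha>) > 0" using \<open>\<alpha> > -1\<close> by (intro Gamma_real_pos) simp
  have u_top: "filterlim u at_top at_top"
    unfolding u_def using \<open>\<theta> \<noteq> 0\<close> by real_asymp
  have inv_u: "filterlim (\<lambda>w. 1 / u w) (at_right 0) at_top"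
    unfolding u_def using \<open>\<theta> \<noteq> 0\<close> by real_asymp
  have inv_w: "filterlim (\<lambda>w::real. 1 / w\<^sup>2) (at_right 0) at_top"
    by real_asymp
  have "2 / \<theta>\<^sup>2 > 0" using \<open>\<theta> \<noteq> 0\<close> by simp
  with L have L_ratio: "((\<lambda>s. L (2 / \<theta>\<^sup>2 * s) / L s) \<longlongrightarrow> 1) (at_right 0)"
    unfolding slowly_varying_at_0_def by blast
  have "(Q \<longlongrightarrow> Gamma (\<alpha> + 1) * 1 * 1 / Gamma (1 + \<alpha>)) at_top"
    unfolding Q_def using G
    by (intro tendsto_intros filterlim_compose[OF laplace_asymptotics u_top]
        filterlim_compose[OF A inv_u] filterlim_compose[OF L_ratio inv_w]) auto
  then have Q: "(Q \<longlongrightarrow> 1) at_top" using G by (simp add: add.commute)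
  have "((\<lambda>w. - (2 / \<theta>\<^sup>2) * ln (Q w)) \<longlongrightarrow> - (2 / \<theta>\<^sup>2) * ln 1) at_top"
    by (intro tendsto_intros Q) simp
  then have lim: "((\<lambda>w. - (2 / \<theta>\<^sup>2) * ln (Q w)) \<longlongrightarrow> 0) at_top" by simp

  have "eventually (\<lambda>s. g s / (L s * s powr \<alpha>) > 0) (at_right 0)"
    using A by (rule order_tendstoD) simp
  \<comment> \<open>\<open>L\<close> inherits its sign from \<open>g\<close>, since their quotient
    up to a power is eventually positive; the logarithm of the product can then be split.\<close>
  then have L_pos: "eventually (\<lambda>s. L s > 0) (at_right 0)"
    using eventually_pos eventually_at_right_less[of 0]
    by eventually_elim (auto simp: zero_less_divide_iff zero_less_mult_iff)
  have "eventually (\<lambda>w. Q w > 0) at_top"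
    using Q by (rule order_tendstoD) simp
  then have "eventually (\<lambda>w. - (2 / \<theta>\<^sup>2) * ln (Q w)
      = l_theta M \<theta> (\<lambda>\<omega>. w * sqrt (S \<omega>) * X \<omega>) - w\<^sup>2 * \<sigma>0\<^sup>2
        - 2 / \<theta>\<^sup>2 * (2 * (1 + \<alpha>) * ln w - ln (Gamma (1 + \<alpha>) * L (1 / w\<^sup>2))
                     + (1 + \<alpha>) * ln (\<theta>\<^sup>2 / 2))) at_top"
    using eventually_gt_at_top[of 0] eventually_compose_filterlim[OF L_pos inv_w]
      eventually_compose_filterlim[OF L_pos inv_u] eventually_compose_filterlim[OF eventually_pos inv_u]
  proof eventually_elim
    case (elim w)
    have uw: "u w > 0" using elim \<open>\<theta> \<noteq> 0\<close> by (simp add: u_def)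
    have inv: "2 / \<theta>\<^sup>2 * (1 / w\<^sup>2) = 1 / u w" by (simp add: u_def)
    have pow: "u w powr (- (1 + \<alpha>)) = 1 / (u w * u w powr \<alpha>)"
      unfolding powr_minus powr_add using uw by (simp add: divide_inverse)
    have "laplace g (u w) = Q w * (Gamma (1 + \<alpha>) * L (1 / w\<^sup>2)) * u w powr (- (1 + \<alpha>))"
      unfolding Q_def inv pow using elim uw G by (simp add: powr_divide)
    then have ln_laplace: "ln (laplace g (u w)) = ln (Q w) + ln (Gamma (1 + \<alpha>) * L (1 / w\<^sup>2)) - (1 + \<alpha>) * ln (u w)"
      using elim uw G by (simp add: ln_mult ln_powr left_diff_distrib distrib_right)
    have ln_u: "ln (u w) = ln (\<theta>\<^sup>2 / 2) + 2 * ln w"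
    proof -
      have "u w = \<theta>\<^sup>2 / 2 * w\<^sup>2" by (simp add: u_def)
      then show ?thesis using elim \<open>\<theta> \<noteq> 0\<close> by (simp add: ln_mult ln_realpow del: times_divide_eq_left)
    qed
    have l: "l_theta M \<theta> (\<lambda>\<omega>. w * sqrt (S \<omega>) * X \<omega>)
        = - (2 / \<theta>\<^sup>2) * (- (u w * \<sigma>0\<^sup>2) + ln (laplace g (u w)))"
    proof -
      have "l_theta M \<theta> (\<lambda>\<omega>. w * sqrt (S \<omega>) * X \<omega>)
          = - (2 / \<theta>\<^sup>2) * ln (exp (- (u w * \<sigma>0\<^sup>2)) * laplace g (u w))"
        unfolding l_theta_def char u_def Re_complex_of_real expectation ..
      then show ?thesis using laplace_pos[of "u w"] uw by (simp add: ln_mult)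
    qed
    have scale: "2 / \<theta>\<^sup>2 * (u w * \<sigma>0\<^sup>2) = w\<^sup>2 * \<sigma>0\<^sup>2"
      using \<open>\<theta> \<noteq> 0\<close> by (simp add: u_def)
    \<comment> \<open>Here \<open>k\<close> is \<open>2 / \<theta>\<^sup>2\<close>, \<open>q\<close>
      is \<open>ln (Q w)\<close>, \<open>v\<close> is \<open>u w * \<sigma>0\<^sup>2\<close>,
      \<open>p\<close> is \<open>ln (Gamma (1 + \<alpha>) * L (1 / w\<^sup>2))\<close>,
      \<open>r\<close> is \<open>ln (\<theta>\<^sup>2 / 2)\<close> and \<open>x\<close> is
      \<open>ln w\<close>.\<close>
    have "- k * q = - k * (- v + (q + p - (1 + \<alpha>) * (r + 2 * x))) - k * v
        - k * (2 * (1 + \<alpha>) * x - p + (1 + \<alpha>) * r)" for k q v p r x :: real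
      by (simp add: algebra_simps)
    then show ?case
      unfolding l ln_laplace ln_u scale[symmetric] .
  qed
  with lim show "((\<lambda>w. l_theta M \<theta> (\<lambda>\<omega>. w * sqrt (S \<omega>) * X \<omega>) - w\<^sup>2 * \<sigma>0\<^sup>2
        - 2 / \<theta>\<^sup>2 * (2 * (1 + \<alpha>) * ln w - ln (Gamma (1 + \<alpha>) * L (1 / w\<^sup>2))
                     + (1 + \<alpha>) * ln (\<theta>\<^sup>2 / 2))) \<longlongrightarrow> 0) at_top"
    by (rule Lim_transform_eventually)
qed

end
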